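(* Suppose $L_1, \ldots, L_{n+1}$ are exchangeable non-negative random variables. Set $$F = \frac{L_{n+1}}{\left(\sum_{j=1}^{n+1} L_j\right)/(n+1)}.$$ Then the expectation satisfies $\mathbf{E}(F) = 1$, and $$P\{F \geq 1/\alpha\} \leq \alpha$$ for any positive $\alpha$.
   Context: Random variables $L_1, \ldots, L_{n+1}$ are exchangeable if their joint distribution is unchanged under permutations: $(L_1, \ldots, L_{n+1})$ and $(L_{\sigma(1)}, \ldots, L_{\sigma(n+1)})$ have the same distribution for every permutation $\sigma$ of $\{1, \ldots, n+1\}$. $P$ denotes probability and $\mathbf{E}$ denotes expectation.
   Formalization: The sum of L_1, …, L_{n+1} is additionally assumed to be nonzero almost surely, since otherwise F is 0/0 with positive probability (for example when all L_i = 0) and is undefined. *)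

theory Defs
  imports "HOL-Probability.Probability"
begin

text \<open>
  Equality of joint laws as measures on the product space. Measurability of the \<open>X i\<close> is not
  part of the definition and has to be assumed separately.
\<close>

definition exchangeable :: "'a measure \<Rightarrow> 'b measure \<Rightarrow> 'i set \<Rightarrow> ('i \<Rightarrow> 'a \<Rightarrow> 'b) \<Rightarrow> bool" where
  "exchangeable M N I X \<longleftrightarrow>
     (\<forall>\<sigma>. \<sigma> permutes I \<longrightarrow>
        distr M (\<Pi>\<^sub>M i\<in>I. N) (\<lambda>\<omega>. \<lambda>i\<in>I. X (\<sigma> i) \<omega>) =
        distr M (\<Pi>\<^sub>M i\<in>I. N) (\<lambda>\<omega>. \<lambda>i\<in>I. X i \<omega>))"

end

theory Submission
  imports Defs
begin

text \<open>
  Exchanging the indices \<open>i\<close> and \<open>n+1\<close> shows that the normalised variables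
  \<open>L i / ((\<Sum>j. L j) / (n+1))\<close> all have the same expectation as \<open>F\<close>. They are bounded, and
  their sum is almost surely \<open>n+1\<close>, so the expectation is \<open>1\<close>. The tail bound is Markov's
  inequality.
\<close>

text \<open>By change of variables, both sides are integrals of \<open>g\<close> against the law of
  a family on the product space, and exchangeability makes the two laws equal. Integrability of
  \<open>g\<close> does not enter, since both sides become the same Bochner integral.\<close>

lemma exchangeable_expectation_eq:
  fixes L :: "'i \<Rightarrow> 'a \<Rightarrow> 'b" and g :: "('i \<Rightarrow> 'b) \<Rightarrow> real"
  assumes "exchangeable M N I L"
    and L: "\<And>i. i \<in> I \<Longrightarrow> L i \<in> measurable M N"
    and \<sigma>: "\<sigma> permutes I"
    and g: "g \<in> borel_measurable (\<Pi>\<^sub>M i\<in>I. N)"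
  shows "(\<integral>\<omega>. g (\<lambda>i\<in>I. L (\<sigma> i) \<omega>) \<partial>M) = (\<integral>\<omega>. g (\<lambda>i\<in>I. L i \<omega>) \<partial>M)"
proof -
  have "(\<lambda>\<omega>. \<lambda>i\<in>I. L (\<sigma> i) \<omega>) \<in> measurable M (\<Pi>\<^sub>M i\<in>I. N)"
    using L permutes_in_image[OF \<sigma>] by (intro measurable_restrict) auto
  then have "(\<integral>\<omega>. g (\<lambda>i\<in>I. L (\<sigma> i) \<omega>) \<partial>M) =
      (\<integral>x. g x \<partial>distr M (\<Pi>\<^sub>M i\<in>I. N) (\<lambda>\<omega>. \<lambda>i\<in>I. L (\<sigma> i) \<omega>))"
    using g by (rule integral_distr[symmetric])
  also have "distr M (\<Pi>\<^sub>M i\<in>I. N) (\<lambda>\<omega>. \<lambda>i\<in>I. L (\<sigma> i) \<omega>) =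
      distr M (\<Pi>\<^sub>M i\<in>I. N) (\<lambda>\<omega>. \<lambda>i\<in>I. L i \<omega>)"
    using assms(1) \<sigma> unfolding exchangeable_def by blast
  also have "(\<integral>x. g x \<partial>\<dots>) = (\<integral>\<omega>. g (\<lambda>i\<in>I. L i \<omega>) \<partial>M)"
    using L g by (intro integral_distr measurable_restrict)
  finally show ?thesis .
qed

text \<open>The denominator is symmetric in the family, so swapping \<open>i\<close> and
  \<open>k\<close> changes only the numerator.\<close>

lemma exchangeable_expectation_normalised_eq:
  fixes L :: "'i \<Rightarrow> 'a \<Rightarrow> real"
  assumes "exchangeable M borel I L"
    and L: "\<And>i. i \<in> I \<Longrightarrow> L i \<in> borel_measurable M"
    and i: "i \<in> I" and k: "k \<in> I"
  shows "(\<integral>\<omega>. L i \<omega> / ((\<Sum>j\<in>I. L j \<omega>) / c) \<partial>M) = (\<integral>\<omega>. L k \<omega> / ((\<Sum>j\<in>I. L j \<omega>) / c) \<partial>M)"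
proof -
  \<comment> \<open>The numerator reads coordinate \<open>k\<close>; in the permuted family that
    coordinate holds \<open>L i\<close>.\<close>
  define g :: "('i \<Rightarrow> real) \<Rightarrow> real" where "g x = x k / ((\<Sum>j\<in>I. x j) / c)" for x
  have \<sigma>: "Transposition.transpose i k permutes I"
    using i k by (rule permutes_swap_id)
  have "g \<in> borel_measurable (\<Pi>\<^sub>M i\<in>I. borel)"
    unfolding g_def using k by measurable
  from exchangeable_expectation_eq[OF assms(1) L \<sigma> this]
  have "(\<integral>\<omega>. g (\<lambda>j\<in>I. L (Transposition.transpose i k j) \<omega>) \<partial>M) = (\<integral>\<omega>. g (\<lambda>j\<in>I. L j \<omega>) \<partial>M)"
    by simp
  moreover have "(\<Sum>j\<in>I. L (Transposition.transpose i k j) \<omega>) = (\<Sum>j\<in>I. L j \<omega>)" for \<omega>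
    using sum.permute[OF \<sigma>, of "\<lambda>j. L j \<omega>"] by (simp add: o_def)
  ultimately show ?thesis
    using k by (simp add: g_def)
qed

text \<open>The sum must be nonzero almost surely for the mean to be 1: where it vanishes, division
  by zero gives \<open>F\<close> the value 0, and the mean would be the probability of a nonzero
  sum.\<close>

theorem theorem1:
  fixes M :: "'a measure" and n :: nat and L :: "nat \<Rightarrow> 'a \<Rightarrow> real" and F :: "'a \<Rightarrow> real"
  assumes "prob_space M"
    and "\<And>i. i \<in> {1..n+1} \<Longrightarrow> L i \<in> borel_measurable M"
    and "\<And>i. i \<in> {1..n+1} \<Longrightarrow> AE \<omega> in M. 0 \<le> L i \<omega>"
    and "exchangeable M borel {1..n+1} L"
    and "AE \<omega> in M. (\<Sum>j=1..n+1. L j \<omega>) \<noteq> 0"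
    and "F = (\<lambda>\<omega>. L (n+1) \<omega> / ((\<Sum>j=1..n+1. L j \<omega>) / real (n+1)))"
  shows "prob_space.expectation M F = 1
    \<and> (\<forall>\<alpha>>0. \<P>(\<omega> in M. F \<omega> \<ge> 1 / \<alpha>) \<le> \<alpha>)"
proof -
  interpret prob_space M by fact
  define S where "S \<omega> = (\<Sum>j=1..n+1. L j \<omega>)" for \<omega>
  define G where "G i \<omega> = L i \<omega> / (S \<omega> / real (n+1))" for i \<omega>
  have F: "F = G (n+1)"
    by (simp add: assms(6) G_def S_def fun_eq_iff)
  have [measurable]: "S \<in> borel_measurable M"
    unfolding S_def using assms(2) by (intro borel_measurable_sum) auto
  have meas: "G i \<in> borel_measurable M" if "i \<in> {1..n+1}" for i
    unfolding G_def using assms(2)[OF that] by measurable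
  have nonneg: "AE \<omega> in M. \<forall>i\<in>{1..n+1}. 0 \<le> L i \<omega>"
    using assms(3) by (intro AE_finite_allI) auto
  \<comment> \<open>Almost surely \<open>S\<close> is positive and, all terms being nonnegative,
    dominates each of them.\<close>
  have bounds: "AE \<omega> in M. \<forall>i\<in>{1..n+1}. 0 \<le> G i \<omega> \<and> G i \<omega> \<le> real (n+1)"
    using nonneg assms(5)
  proof eventually_elim
    case (elim \<omega>)
    have "0 \<le> S \<omega>"
      unfolding S_def using elim(1) by (intro sum_nonneg) auto
    with elim(2) have pos: "0 < S \<omega>"
      by (simp add: S_def)
    have le: "L i \<omega> \<le> S \<omega>" if "i \<in> {1..n+1}" for i
      unfolding S_def using elim(1) that by (intro member_le_sum) auto
    show ?case
    proof (intro ballI conjI)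
      fix i assume i: "i \<in> {1..n+1}"
      show "0 \<le> G i \<omega>"
        unfolding G_def using elim(1) i pos by auto
      have "L i \<omega> / S \<omega> \<le> 1"
        using le[OF i] pos by simp
      then have "L i \<omega> / S \<omega> * real (n+1) \<le> 1 * real (n+1)"
        by (rule mult_right_mono) simp
      then show "G i \<omega> \<le> real (n+1)"
        by (simp add: G_def)
    qed
  qed
  \<comment> \<open>Boundedness suffices on a probability space, so no moment of \<open>L i\<close>
    itself is involved.\<close>
  have int: "integrable M (G i)" if "i \<in> {1..n+1}" for i
    using bounds meas[OF that] that
    by (intro integrable_const_bound[of _ "real (n+1)"]) (auto elim!: eventually_mono)
  have eq: "expectation (G i) = expectation (G (n+1))" if "i \<in> {1..n+1}" for i
    unfolding G_def S_def
    by (rule exchangeable_expectation_normalised_eq[OF assms(4,2) that]) auto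
  have "real (n+1) * expectation (G (n+1)) = (\<Sum>i=1..n+1. expectation (G i))"
    by (subst sum.cong[OF refl eq]) auto
  also have "\<dots> = expectation (\<lambda>\<omega>. \<Sum>i=1..n+1. G i \<omega>)"
    using int by (subst Bochner_Integration.integral_sum) auto
  \<comment> \<open>The sum of the \<open>G i\<close> is \<open>S / (S / (n+1))\<close>, which
    equals \<open>n+1\<close> only where \<open>S\<close> is nonzero; hence an almost sure
    equality.\<close>
  also have "\<dots> = expectation (\<lambda>_. real (n+1))"
  proof (rule integral_cong_AE)
    show "AE \<omega> in M. (\<Sum>i=1..n+1. G i \<omega>) = real (n+1)"
      using assms(5)
      unfolding G_def sum_divide_distrib[symmetric] S_def[symmetric]
      by eventually_elim simp
  qed (use meas in \<open>auto intro!: borel_measurable_sum\<close>)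
  also have "\<dots> = real (n+1)"
    by (simp add: prob_space)
  finally have E: "expectation F = 1"
    unfolding F by simp
  have "\<P>(\<omega> in M. F \<omega> \<ge> 1 / \<alpha>) \<le> \<alpha>" if "\<alpha> > 0" for \<alpha>
  proof -
    have "AE \<omega> in M. 0 \<le> F \<omega>"
      using bounds unfolding F by eventually_elim auto
    \<comment> \<open>Markov's inequality at the positive threshold \<open>1 / \<alpha>\<close>;
      since the mean is 1, the bound is \<open>\<alpha>\<close>.\<close>
    then have "\<P>(\<omega> in M. F \<omega> \<ge> 1 / \<alpha>) \<le> expectation F / (1 / \<alpha>)"
      using int[of "n+1"] that unfolding F
      by (intro integral_Markov_inequality_measure[of _ _ "{}"]) auto
    then show ?thesis
      by (simp add: E)
  qed
  with E show ?thesis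
    by blast
qed

end
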